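(* Let $\mathcal{F}_1$ be the family of all lines in $\mathbb{R}^2$ and let $\mathcal{F}_3=\{l_1\cup l_2\cup l_3 : l_1,l_2,l_3\in\mathcal{F}_1\}$. Then $\mathsf{VC}\text{-}\mathsf{dim}(\mathcal{F}_3)=9$.
   Context: A family $\mathcal{S}$ of subsets of $X$ shatters $Y\subseteq X$ if for every $Z\subseteq Y$ there is $S\in\mathcal{S}$ with $S\cap Y=Z$. The VC-dimension $\mathsf{VC}\text{-}\mathsf{dim}(\mathcal{S})$ is the largest $n$ such that some $Y\subseteq X$ with $|Y|=n$ is shattered by $\mathcal{S}$. Here $X=\mathbb{R}^2$. *)

theory Defs
  imports "HOL-Analysis.Analysis" "HOL-Library.Extended_Nat"
begin

definition shatters :: "'a set set \<Rightarrow> 'a set \<Rightarrow> bool" where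
  "shatters \<S> Y \<longleftrightarrow> (\<forall>Z. Z \<subseteq> Y \<longrightarrow> (\<exists>S\<in>\<S>. S \<inter> Y = Z))"

text \<open>
  The value is in \<^typ>\<open>enat\<close>, so that arbitrarily large finite shattered sets give \<open>\<infinity>\<close>;
  a finite nonzero value is attained, hence is a maximum. The condition \<^term>\<open>finite Y\<close> is
  needed because \<^const>\<open>card\<close> is \<open>0\<close> on infinite sets.
\<close>
definition VC_dim :: "'a set \<Rightarrow> 'a set set \<Rightarrow> enat" where
  "VC_dim X \<S> = Sup {enat n | n. \<exists>Y. Y \<subseteq> X \<and> finite Y \<and> card Y = n \<and> shatters \<S> Y}"

definition plane_lines :: "(real ^ 2) set set" where
  "plane_lines = {l. affine l \<and> aff_dim l = 1}"

definition three_line_unions :: "(real ^ 2) set set" where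
  "three_line_unions =
    {l1 \<union> l2 \<union> l3 | l1 l2 l3. l1 \<in> plane_lines \<and> l2 \<in> plane_lines \<and> l3 \<in> plane_lines}"

end

theory Submission imports Defs begin

text \<open>
  Upper bound: two distinct lines share at most one point, so if \<open>k\<close> points of a line are covered by
  fewer than \<open>k\<close> lines, the line itself is among them. Suppose ten points are shattered.
  Deleting a point shows that no line contains five of them, and as three lines cover them all, some
  line \<open>l\<close> contains exactly four. The six others are covered by two lines \<open>m\<close> and \<open>n\<close>. If \<open>m\<close>
  contains four of these, delete a point of \<open>l\<close>: then \<open>m\<close> must be used, and the three remaining
  points of \<open>l\<close> force \<open>l\<close> to be used as well. Otherwise \<open>m\<close> and \<open>n\<close> contain three each; deleting a
  point of \<open>n\<close> forces first \<open>l\<close>, then \<open>m\<close>, then \<open>n\<close> to be used.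

  Lower bound: an explicit configuration of nine points, spanning two lines with four points and
  three lines with three points, is checked by computation.
\<close>

section \<open>Upper bound\<close>

lemma pigeonhole_cover:
  assumes "finite F" "Y \<subseteq> \<Union>F" "card F * r < card Y"
  shows "\<exists>k\<in>F. r < card (k \<inter> Y)"
proof (rule ccontr)
  assume "\<not> ?thesis"
  then have "(\<Sum>k\<in>F. card (k \<inter> Y)) \<le> card F * r"
    using sum_bounded_above[of F "\<lambda>k. card (k \<inter> Y)" r] by (simp add: not_less)
  moreover have "(\<Union>k\<in>F. k \<inter> Y) = Y"
    using assms(2) by blast
  then have "card Y \<le> (\<Sum>k\<in>F. card (k \<inter> Y))"
    using card_UN_le[OF assms(1), of "\<lambda>k. k \<inter> Y"] by simp
  ultimately show False
    using assms(3) by simp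
qed

text \<open>Known as a linear hypergraph. This is all that the counting argument uses of lines, so
  it needs no geometry.\<close>

definition linear_family :: "'a set set \<Rightarrow> bool" where
  "linear_family \<L> \<longleftrightarrow> (\<forall>k\<in>\<L>. \<forall>l\<in>\<L>. \<forall>x y. x \<in> k \<inter> l \<and> y \<in> k \<inter> l \<and> x \<noteq> y \<longrightarrow> k = l)"

lemma linear_family_forced:
  assumes lin: "linear_family \<L>" and F: "F \<subseteq> \<L>" "finite F" and k: "k \<in> \<L>"
    and S: "S \<subseteq> k" "S \<subseteq> \<Union>F" "card F < card S"
  shows "k \<in> F"
proof -
  have "\<forall>x\<in>S. \<exists>j. j \<in> F \<and> x \<in> j"
    using S(2) by blast
  from bchoice[OF this] obtain f where f: "\<And>x. x \<in> S \<Longrightarrow> f x \<in> F \<and> x \<in> f x"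
    by blast
  have "card (f ` S) \<le> card F"
    using f F(2) by (intro card_mono) auto
  \<comment> \<open>Two points of \<open>S\<close> receive the same member of \<open>F\<close>,
    which then meets \<open>k\<close> twice.\<close>
  then have "\<not> inj_on f S"
    using S(3) card_image by fastforce
  then obtain x y where xy: "x \<in> S" "y \<in> S" "x \<noteq> y" "f x = f y"
    by (auto simp: inj_on_def)
  have "f x \<in> \<L>" "x \<in> k \<inter> f x" "y \<in> k \<inter> f x"
    using f[OF xy(1)] f[OF xy(2)] F(1) S(1) xy by auto
  then have "k = f x"
    using lin k xy(3) unfolding linear_family_def by blast
  then show ?thesis
    using f xy(1) by simp
qed

text \<open>Cuts are made by sets of at most three members rather than by triples, so that a forced
  member can be taken out and the rest counted again.\<close>

lemma ten_points_not_cut_out_by_three: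
  assumes lin: "linear_family \<L>" and Y: "finite Y" "card Y = 10"
    and cut: "\<And>Z. Z \<subseteq> Y \<Longrightarrow> \<exists>F\<subseteq>\<L>. finite F \<and> card F \<le> 3 \<and> \<Union>F \<inter> Y = Z"
  shows False
proof -
  \<comment> \<open>Each contradiction below consists in forcing a line through the deleted point
    into such a cover.\<close>
  have delete: "\<exists>F\<subseteq>\<L>. finite F \<and> card F \<le> 3 \<and> Y - {u} \<subseteq> \<Union>F \<and> (\<forall>k\<in>F. u \<notin> k)" if "u \<in> Y" for u
  proof -
    obtain F where "F \<subseteq> \<L>" "finite F" "card F \<le> 3" "\<Union>F \<inter> Y = Y - {u}"
      using cut[of "Y - {u}"] by auto
    then show ?thesis
      using that by (intro exI[of _ F] conjI) auto
  qed
  have le4: "card (k \<inter> Y) \<le> 4" if k: "k \<in> \<L>" for k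
  proof (rule ccontr)
    assume *: "\<not> ?thesis"
    then have "k \<inter> Y \<noteq> {}"
      by (metis card.empty zero_le)
    then obtain u where u: "u \<in> k \<inter> Y"
      by blast
    obtain F where F: "F \<subseteq> \<L>" "finite F" "card F \<le> 3" "Y - {u} \<subseteq> \<Union>F" "\<forall>k\<in>F. u \<notin> k"
      using delete[of u] u by auto
    have "card (k \<inter> Y - {u}) \<ge> 4"
      using * u Y by simp
    then have "k \<in> F"
      using F by (intro linear_family_forced[OF lin F(1,2) k, of "k \<inter> Y - {u}"]) auto
    then show False
      using F(5) u by blast
  qed
  obtain F where F: "F \<subseteq> \<L>" "finite F" "card F \<le> 3" "\<Union>F \<inter> Y = Y"
    using cut[of Y] by auto
  \<comment> \<open>Three lines with at most three points each would reach only nine of the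
    ten.\<close>
  have "\<exists>l\<in>F. 3 < card (l \<inter> Y)"
    using F Y by (intro pigeonhole_cover) auto
  then obtain l where l: "l \<in> F" "3 < card (l \<inter> Y)"
    by blast
  have lL: "l \<in> \<L>" and l4: "card (l \<inter> Y) = 4"
    using l F(1) le4[of l] by auto
  define R where "R = Y - l"
  have R: "finite R" "card R = 6"
    using Y l4 card_Diff_subset_Int[of Y l] by (auto simp: R_def Int_commute)
  define G where "G = F - {l}"
  have G: "G \<subseteq> \<L>" "finite G" "card G \<le> 2" "R \<subseteq> \<Union>G"
    using F l(1) by (auto simp: G_def R_def)
  have "\<exists>m\<in>G. 2 < card (m \<inter> R)"
    using G R by (intro pigeonhole_cover) auto
  then obtain m where m: "m \<in> G" "2 < card (m \<inter> R)"
    by blast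
  have mL: "m \<in> \<L>"
    using m G by blast
  have le3: "card (k \<inter> R) \<le> 3" if k: "k \<in> \<L>" for k
  proof (rule ccontr)
    assume *: "\<not> ?thesis"
    have "card (k \<inter> R) \<le> card (k \<inter> Y)"
      using Y(1) by (intro card_mono) (auto simp: R_def)
    then have "card (k \<inter> R) = card (k \<inter> Y)"
      using * le4[OF k] by simp
    \<comment> \<open>No point of \<open>Y\<close> on \<open>k\<close> lies on \<open>l\<close>, so
      once \<open>k\<close> is forced, the three points of \<open>l\<close> other than
      \<open>a\<close> are left to two lines.\<close>
    then have kR: "k \<inter> R = k \<inter> Y"
      using Y(1) by (intro card_subset_eq) (auto simp: R_def)
    obtain a where a: "a \<in> l \<inter> Y"
      using l4 by (metis card.empty ex_in_conv zero_neq_numeral)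
    obtain H where H: "H \<subseteq> \<L>" "finite H" "card H \<le> 3" "Y - {a} \<subseteq> \<Union>H" "\<forall>k\<in>H. a \<notin> k"
      using delete[of a] a by auto
    have "k \<in> H"
      using * H a by (intro linear_family_forced[OF lin H(1,2) k, of "k \<inter> R"]) (auto simp: R_def)
    then have H': "H - {k} \<subseteq> \<L>" "finite (H - {k})" "card (H - {k}) \<le> 2"
      using H by auto
    have "l \<inter> Y - {a} \<subseteq> \<Union>(H - {k})"
      using H(4) kR by (auto simp: R_def)
    moreover have "card (l \<inter> Y - {a}) = 3"
      using a l4 by simp
    ultimately have "l \<in> H - {k}"
      using H'(3) by (intro linear_family_forced[OF lin H'(1,2) lL, of "l \<inter> Y - {a}"]) auto
    then show False
      using H(5) a by blast
  qed
  define N where "N = R - m"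
  have m3: "card (m \<inter> R) = 3"
    using m le3[OF mL] by simp
  then have N3: "card N = 3"
    using R card_Diff_subset_Int[of R m] by (simp add: N_def Int_commute)
  have "card (G - {m}) \<le> 1"
    using G m(1) by simp
  moreover have "G - {m} \<noteq> {}"
  proof
    assume "G - {m} = {}"
    then have "N = {}"
      using G(4) by (auto simp: N_def)
    then show False
      using N3 by simp
  qed
  then have "card (G - {m}) > 0"
    using G(2) by (simp add: card_gt_0_iff)
  ultimately have "card (G - {m}) = 1"
    by linarith
  then obtain n where n: "G - {m} = {n}"
    by (rule card_1_singletonE)
  have nL: "n \<in> \<L>"
    using n G(1) by blast
  have "\<Union>G \<subseteq> m \<union> n"
    using n by blast
  then have "R \<subseteq> m \<union> n"
    using G(4) by (rule subset_trans[rotated])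
  then have Nn: "N \<subseteq> n"
    by (auto simp: N_def)
  obtain u where u: "u \<in> N"
    using N3 by (metis card.empty ex_in_conv zero_neq_numeral)
  then have uY: "u \<in> Y"
    by (simp add: N_def R_def)
  obtain H where H: "H \<subseteq> \<L>" "finite H" "card H \<le> 3" "Y - {u} \<subseteq> \<Union>H" "\<forall>k\<in>H. u \<notin> k"
    using delete[OF uY] by auto
  \<comment> \<open>As \<open>u\<close> lies off \<open>l\<close> and \<open>m\<close>, the counts
    are four points against three lines, three against two and two against one. The line forced
    last, \<open>n\<close>, passes through \<open>u\<close>.\<close>
  have "l \<in> H"
    using H l4 u
    by (intro linear_family_forced[OF lin H(1,2) lL, of "l \<inter> Y"]) (auto simp: N_def R_def)
  then have H': "H - {l} \<subseteq> \<L>" "finite (H - {l})" "card (H - {l}) \<le> 2"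
    using H by auto
  have "m \<inter> R \<subseteq> \<Union>(H - {l})"
    using H(4) u by (auto simp: R_def N_def)
  then have "m \<in> H - {l}"
    using H'(3) m3 by (intro linear_family_forced[OF lin H'(1,2) mL, of "m \<inter> R"]) auto
  then have H'': "H - {l} - {m} \<subseteq> \<L>" "finite (H - {l} - {m})" "card (H - {l} - {m}) \<le> 1"
    using H' by auto
  have "N - {u} \<subseteq> \<Union>(H - {l} - {m})"
    using H(4) by (auto simp: R_def N_def)
  moreover have "card (N - {u}) = 2"
    using u N3 by simp
  ultimately have "n \<in> H - {l} - {m}"
    using H''(3) Nn by (intro linear_family_forced[OF lin H''(1,2) nL, of "N - {u}"]) auto
  then show False
    using H(5) u Nn by blast
qed

text \<open>A line through two distinct points contains their affine hull, which has the same
  dimension, so the two coincide.\<close>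

lemma linear_family_plane_lines: "linear_family plane_lines"
  unfolding linear_family_def
proof (intro ballI allI impI)
  fix k l :: "(real ^ 2) set" and x y
  assume kl: "k \<in> plane_lines" "l \<in> plane_lines" and xy: "x \<in> k \<inter> l \<and> y \<in> k \<inter> l \<and> x \<noteq> y"
  have "affine hull {x, y} = j" if "j \<in> plane_lines" "x \<in> j" "y \<in> j" for j
    using that xy
    by (intro affine_dim_equal) (auto simp: plane_lines_def aff_dim_2 hull_minimal)
  then show "k = l"
    using kl xy by blast
qed

lemma shatters_mono: "shatters \<S> Y \<Longrightarrow> X \<subseteq> Y \<Longrightarrow> shatters \<S> X"
  unfolding shatters_def
proof (intro allI impI)
  fix Z assume *: "\<forall>Z\<subseteq>Y. \<exists>S\<in>\<S>. S \<inter> Y = Z" "X \<subseteq> Y" "Z \<subseteq> X"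
  then obtain S where "S \<in> \<S>" "S \<inter> Y = Z"
    by (meson subset_trans)
  then show "\<exists>S\<in>\<S>. S \<inter> X = Z"
    using *(2,3) by (intro bexI[of _ S]) auto
qed

lemma shattered_by_three_lines_card_le:
  assumes "finite Y" "shatters three_line_unions Y"
  shows "card Y \<le> 9"
proof (rule ccontr)
  assume "\<not> ?thesis"
  then obtain X where X: "X \<subseteq> Y" "card X = 10" "finite X"
    using obtain_subset_with_card_n[of 10 Y] by auto
  have "\<exists>F\<subseteq>plane_lines. finite F \<and> card F \<le> 3 \<and> \<Union>F \<inter> X = Z" if "Z \<subseteq> X" for Z
  proof -
    have "\<exists>S\<in>three_line_unions. S \<inter> X = Z"
      using shatters_mono[OF assms(2) X(1)] that by (simp add: shatters_def)
    then obtain S where "S \<in> three_line_unions" "S \<inter> X = Z"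
      by (rule bexE)
    then obtain l1 l2 l3 where "{l1, l2, l3} \<subseteq> plane_lines" "(l1 \<union> l2 \<union> l3) \<inter> X = Z"
      by (auto simp: three_line_unions_def)
    \<comment> \<open>The three lines may coincide, hence only an inequality.\<close>
    moreover have "card {l1, l2, l3} \<le> 3"
      using card_length[of "[l1, l2, l3]"] by simp
    ultimately show ?thesis
      by (intro exI[of _ "{l1, l2, l3}"]) (auto simp: Un_assoc)
  qed
  then show False
    using ten_points_not_cut_out_by_three[OF linear_family_plane_lines X(3,2)] by blast
qed

section \<open>Lower bound\<close>

lemma linear_equation_plane_line:
  fixes a b c :: real
  assumes "(a, b) \<noteq> (0, 0)"
  shows "{v :: real ^ 2. a * v $ 1 + b * v $ 2 = c} \<in> plane_lines"
proof -
  have "vector [a, b] \<noteq> (0 :: real ^ 2)"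
    using assms by (auto simp: vec_eq_iff forall_2)
  moreover have "{v :: real ^ 2. a * v $ 1 + b * v $ 2 = c} = {v. vector [a, b] \<bullet> v = c}"
    by (simp add: inner_vec_def sum_2)
  ultimately show ?thesis
    by (simp add: plane_lines_def affine_hyperplane)
qed

definition nine_points :: "(int \<times> int) list" where
  "nine_points =
    [(0, 0), (-2, 0), (1, 0), (0, -1), (0, 2), (-1, 0), (0, 1), (2, -2), (-2, -1)]"

text \<open>
  An entry \<open>((a, b, c), t)\<close> states that the line \<open>a x + b y = c\<close> contains precisely the points with
  indices in \<open>t\<close>.
\<close>
definition line_traces :: "((int \<times> int \<times> int) \<times> nat list) list" where
  "line_traces =
    [((0, 1, 0), [0, 1, 2, 5]), ((1, 0, 0), [0, 3, 4, 6]), ((1, 2, -2), [1, 3, 7]),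
     ((2, 1, 2), [2, 4, 7]), ((1, -1, -1), [5, 6, 8]), ((1, 1, 0), [0, 7]), ((1, -2, 0), [0, 8]),
     ((1, -1, -2), [1, 4]), ((1, -2, -2), [1, 6]), ((1, -1, 1), [2, 3]), ((1, 1, 1), [2, 6]),
     ((1, -3, 1), [2, 8]), ((1, 1, -1), [3, 5]), ((2, -1, -2), [4, 5]), ((3, -2, -4), [4, 8]),
     ((2, 3, -2), [5, 7]), ((3, 2, 2), [6, 7]), ((1, 4, -6), [7, 8]), ((3, 1, 0), [0]),
     ((3, 1, -6), [1]), ((3, 1, 3), [2]), ((3, 1, -1), [3]), ((3, 1, 2), [4]), ((3, 1, -3), [5]),
     ((3, 1, 1), [6]), ((3, 1, 4), [7]), ((3, 1, -7), [8]), ((3, 1, 99), [])]"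

text \<open>The last ten entries are parallel: \<open>3 x + y\<close> takes distinct values at the
  nine points, and never 99, which yields all singleton traces and the empty one.\<close>

lemma line_traces_correct:
  "\<forall>((a, b, c), t) \<in> set line_traces. (a, b) \<noteq> (0, 0) \<and>
    filter (\<lambda>i. a * fst (nine_points ! i) + b * snd (nine_points ! i) = c) [0..<9] = t"
  by code_simp

text \<open>Only traces inside \<open>Z\<close> are kept, so covering \<open>Z\<close> is enough for
  equality.\<close>

lemma subsets_are_unions_of_three_traces:
  "\<forall>Z \<in> set (subseqs [0..<9]).
    let T = filter (\<lambda>t. set t \<subseteq> set Z) (map snd line_traces) in
    \<exists>t\<in>set T. \<exists>u\<in>set T. \<exists>v\<in>set T. \<forall>i\<in>set Z. i \<in> set t \<or> i \<in> set u \<or> i \<in> set v"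
  by code_simp

lemma nine_points_shattered:
  "\<exists>Y :: (real ^ 2) set. finite Y \<and> card Y = 9 \<and> shatters three_line_unions Y"
proof -
  define p :: "nat \<Rightarrow> real ^ 2" where
    "p = (\<lambda>i. vector [of_int (fst (nine_points ! i)), of_int (snd (nine_points ! i))])"
  have "distinct nine_points" "length nine_points = 9"
    by (simp_all add: nine_points_def)
  then have "inj_on (nth nine_points) {..<9}"
    by (simp add: inj_on_nth)
  then have inj: "inj_on p {..<9}"
    by (simp add: inj_on_def p_def vec_eq_iff forall_2 prod_eq_iff)
  have line: "\<exists>l\<in>plane_lines. \<forall>i<9. p i \<in> l \<longleftrightarrow> i \<in> set t" if t: "t \<in> snd ` set line_traces" for t
  proof -
    obtain a b c where "((a, b, c), t) \<in> set line_traces"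
      using t by force
    then have ab: "(a, b) \<noteq> (0, 0)"
      and tr: "t = filter (\<lambda>i. a * fst (nine_points ! i) + b * snd (nine_points ! i) = c) [0..<9]"
      using line_traces_correct by fastforce+
    define l where "l = {v :: real ^ 2. of_int a * v $ 1 + of_int b * v $ 2 = of_int c}"
    have "p i \<in> l \<longleftrightarrow> i \<in> set t" if "i < 9" for i
    proof -
      \<comment> \<open>Both sides are casts of integers, so the computed table decides incidence in
        the real plane.\<close>
      have "p i \<in> l \<longleftrightarrow> real_of_int (a * fst (nine_points ! i) + b * snd (nine_points ! i)) = of_int c"
        by (simp add: l_def p_def)
      then show ?thesis
        using that by (simp only: of_int_eq_iff) (simp add: tr)
    qed
    moreover have "l \<in> plane_lines"
      unfolding l_def using ab by (intro linear_equation_plane_line) auto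
    ultimately show ?thesis
      by blast
  qed
  have "shatters three_line_unions (p ` {..<9})"
    unfolding shatters_def
  proof (intro allI impI)
    fix Z assume "Z \<subseteq> p ` {..<9}"
    then obtain I where I: "I \<subseteq> {..<9}" "Z = p ` I"
      by (metis subset_imageE)
    have "I \<in> set ` set (subseqs [0..<9])"
      using I(1) by (auto simp: subseqs_powset)
    then obtain Z' where Z': "Z' \<in> set (subseqs [0..<9])" "I = set Z'"
      by blast
    define T where "T = filter (\<lambda>t. set t \<subseteq> I) (map snd line_traces)"
    obtain t u v where "t \<in> set T" "u \<in> set T" "v \<in> set T"
        "\<forall>i\<in>I. i \<in> set t \<or> i \<in> set u \<or> i \<in> set v"
      using bspec[OF subsets_are_unions_of_three_traces Z'(1)]
      unfolding Let_def Z'(2)[symmetric] T_def[symmetric] by blast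
    then have tuv: "{t, u, v} \<subseteq> snd ` set line_traces" "I = set t \<union> set u \<union> set v"
      by (auto simp: T_def)
    then obtain k l m where klm: "k \<in> plane_lines" "l \<in> plane_lines" "m \<in> plane_lines"
      "\<forall>i<9. p i \<in> k \<longleftrightarrow> i \<in> set t" "\<forall>i<9. p i \<in> l \<longleftrightarrow> i \<in> set u" "\<forall>i<9. p i \<in> m \<longleftrightarrow> i \<in> set v"
      using line[of t] line[of u] line[of v] by auto
    then have "(k \<union> l \<union> m) \<inter> p ` {..<9} = Z"
      using I tuv(2) by auto
    then show "\<exists>S\<in>three_line_unions. S \<inter> p ` {..<9} = Z"
      using klm(1-3) unfolding three_line_unions_def by blast
  qed
  then show ?thesis
    using card_image[OF inj] by (intro exI[of _ "p ` {..<9}"]) simp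
qed

theorem corollary6p20:
  "VC_dim (UNIV :: (real ^ 2) set) three_line_unions = 9"
  unfolding VC_dim_def
proof (rule antisym)
  show "Sup {enat n | n. \<exists>Y \<subseteq> (UNIV :: (real ^ 2) set).
    finite Y \<and> card Y = n \<and> shatters three_line_unions Y} \<le> 9"
    using shattered_by_three_lines_card_le
    by (intro Sup_least) (auto simp: numeral_eq_enat)
  show "9 \<le> Sup {enat n | n. \<exists>Y \<subseteq> (UNIV :: (real ^ 2) set).
    finite Y \<and> card Y = n \<and> shatters three_line_unions Y}"
    using nine_points_shattered by (intro Sup_upper) (auto simp: numeral_eq_enat)
qed

end
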